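(* For every fixed $r > 0$, the function $$s \mapsto \theta_3(rs)\,\theta_3\!\left(\frac{r}{s}\right) - 2\,\theta_o(rs)\,\theta_o\!\left(\frac{r}{s}\right), \qquad s>0,$$ attains its minimum at $s = 1$.
   Context: For $s>0$, $\theta_3(s) = \sum_{k\in\mathbb{Z}} e^{-\pi k^2 s}$ and $\theta_o(s) = \sum_{k\in\mathbb{Z}} e^{-\pi (2k+1)^2 s}$. *)

theory Defs
  imports "HOL-Analysis.Analysis"
begin

definition theta3 :: "real \<Rightarrow> real" where
  "theta3 s = (\<Sum>\<^sub>\<infinity>k::int. exp (- pi * (real_of_int k)\<^sup>2 * s))"

definition theta_o :: "real \<Rightarrow> real" where
  "theta_o s = (\<Sum>\<^sub>\<infinity>k::int. exp (- pi * (2 * real_of_int k + 1)\<^sup>2 * s))"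

end

theory Submission
  imports Defs "HOL-Probability.Characteristic_Functions"
begin

text \<open>
  The two products behave oppositely: \<open>theta3 (r * s) * theta3 (r / s)\<close> is minimal and
  \<open>theta_o (r * s) * theta_o (r / s)\<close> is maximal at \<open>s = 1\<close>, because \<open>ln theta3\<close> is convex
  and \<open>ln theta2\<close> (where \<open>theta_o s = theta2 (4 * s)\<close>) is concave as a function of \<open>ln s\<close>.
  Poisson summation gives \<open>theta3 s = theta3 (1 / s) / sqrt s\<close> and
  \<open>theta2 s = theta4 (1 / s) / sqrt s\<close>, which reduces both claims to the monotonicity of the
  logarithmic derivatives \<open>s * f' s / f s\<close> of \<open>theta2\<close>, \<open>theta3\<close>, \<open>theta4\<close> on \<open>s \<ge> 1\<close>. There
  \<open>q = exp (- pi * s)\<close> is so small that crude bounds on the power series in \<open>q\<close> suffice.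
\<close>

subsection \<open>Poisson summation for Gaussians\<close>

text \<open>The Fourier transform of a Gaussian, obtained by rescaling the characteristic function
  \<open>exp (- u^2 / 2)\<close> of the standard normal distribution and taking real parts.\<close>

lemma has_bochner_integral_gaussian_cos:
  fixes s t :: real
  assumes s: "s > 0"
  shows "has_bochner_integral lborel (\<lambda>x. exp (- pi * x\<^sup>2 * s) * cos (2 * pi * t * x))
           (exp (- pi * t\<^sup>2 / s) / sqrt s)"
proof -
  interpret N: real_distribution std_normal_distribution by (rule real_dist_normal_dist)
  \<comment> \<open>The substitution \<open>x -> c * x\<close> turns \<open>exp (- x^2 / 2)\<close>
    into \<open>exp (- pi * x^2 * s)\<close>, and \<open>u\<close> below is the frequency with
    \<open>u * c = 2 * pi * t\<close>.\<close>
  define c where "c = sqrt (2 * pi * s)"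
  have c: "c > 0" "c\<^sup>2 = 2 * pi * s" using s by (auto simp: c_def)
  define u where "u = 2 * pi * t / c"
  have int: "integrable std_normal_distribution (\<lambda>x. exp (\<i> * complex_of_real (u * x)))"
    by (rule N.integrable_iexp) auto
  have "(\<integral>x. Re (exp (\<i> * complex_of_real (u * x))) \<partial>std_normal_distribution) = Re (char std_normal_distribution u)"
    unfolding char_def using int by (subst integral_Re) auto
  also have "\<dots> = exp (- u\<^sup>2 / 2)" by (simp add: char_std_normal_distribution)
  finally have "(\<integral>x. cos (u * x) \<partial>std_normal_distribution) = exp (- u\<^sup>2 / 2)"
    by (simp add: Re_exp)
  moreover have "integrable std_normal_distribution (\<lambda>x. cos (u * x))"
    using integrable_Re[OF int] by (simp add: Re_exp)
  moreover have "(\<integral>x. cos (u * x) \<partial>std_normal_distribution) = (\<integral>x. std_normal_density x *\<^sub>R cos (u * x) \<partial>lborel)"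
    by (rule integral_density) auto
  moreover have "integrable std_normal_distribution (\<lambda>x. cos (u * x)) \<longleftrightarrow>
      integrable lborel (\<lambda>x. std_normal_density x *\<^sub>R cos (u * x))"
    by (rule integrable_density) auto
  ultimately have "has_bochner_integral lborel (\<lambda>x. std_normal_density x * cos (u * x)) (exp (- u\<^sup>2 / 2))"
    by (simp add: has_bochner_integral_iff)
  then have "has_bochner_integral lborel (\<lambda>x. std_normal_density (0 + c * x) * cos (u * (0 + c * x))) (exp (- u\<^sup>2 / 2) /\<^sub>R \<bar>c\<bar>)"
    by (rule iffD1[OF lborel_has_bochner_integral_real_affine_iff
          [of c "\<lambda>x. std_normal_density x * cos (u * x)" _ 0], rotated]) (use c(1) in simp)
  moreover have "exp (- u\<^sup>2 / 2) /\<^sub>R \<bar>c\<bar> = exp (- u\<^sup>2 / 2) / c"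
    using c(1) by (simp add: field_simps)
  ultimately have "has_bochner_integral lborel (\<lambda>x. std_normal_density (c * x) * cos (u * (c * x))) (exp (- u\<^sup>2 / 2) / c)"
    by (simp only: add_0_left)
  then have "has_bochner_integral lborel (\<lambda>x. sqrt (2 * pi) * (std_normal_density (c * x) * cos (u * (c * x))))
      (sqrt (2 * pi) * (exp (- u\<^sup>2 / 2) / c))"
    by (rule has_bochner_integral_mult_right)
  moreover have "sqrt (2 * pi) * (std_normal_density (c * x) * cos (u * (c * x))) =
      exp (- pi * x\<^sup>2 * s) * cos (2 * pi * t * x)" for x
    using c by (simp add: std_normal_density_def u_def power_mult_distrib mult_ac)
  moreover have "sqrt (2 * pi) * (exp (- u\<^sup>2 / 2) / c) = exp (- pi * t\<^sup>2 / s) / sqrt s"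
  proof -
    have u: "- u\<^sup>2 / 2 = - pi * t\<^sup>2 / s"
      using s c by (simp add: u_def power_divide power_mult_distrib field_simps power2_eq_square)
    have "sqrt (2 * pi) / c = 1 / sqrt s"
      by (simp add: c_def real_sqrt_mult)
    then have "exp (- u\<^sup>2 / 2) * (sqrt (2 * pi) / c) = exp (- u\<^sup>2 / 2) * (1 / sqrt s)"
      by (rule arg_cong)
    then show ?thesis unfolding u by (simp add: mult.commute)
  qed
  ultimately show ?thesis by simp
qed

text \<open>The map \<open>n -> - 1 - n\<close> enumerates the negative integers, so 0 is counted
  once. The reflection \<open>k -> - 1 - k\<close> also preserves \<open>(k + 1 / 2)^2\<close>,
  which suits the series of \<open>theta2\<close>.\<close>

lemma has_sum_int_split:
  fixes f :: "int \<Rightarrow> real"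
  assumes "((\<lambda>n. f (int n)) has_sum a) UNIV" "((\<lambda>n. f (- 1 - int n)) has_sum b) UNIV"
  shows "(f has_sum (a + b)) UNIV"
proof -
  have "(f has_sum a) (range int)"
    using assms(1) by (subst has_sum_reindex) (auto simp: o_def)
  moreover have "(f has_sum b) (range (\<lambda>n. - 1 - int n))"
    using assms(2) by (subst has_sum_reindex) (auto simp: o_def inj_on_def)
  ultimately have "(f has_sum (a + b)) (range int \<union> range (\<lambda>n. - 1 - int n))"
    by (rule has_sum_Un_disjoint) auto
  also have "range int \<union> range (\<lambda>n. - 1 - int n) = UNIV"
  proof -
    have "x \<in> range int \<union> range (\<lambda>n. - 1 - int n)" for x :: int
      by (cases "x \<ge> 0") (auto intro: image_eqI[of _ _ "nat x"] image_eqI[of _ _ "nat (- 1 - x)"])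
    then show ?thesis by blast
  qed
  finally show ?thesis .
qed

lemma summable_on_exp_abs_int:
  fixes c :: real
  assumes "c > 0"
  shows "(\<lambda>k::int. exp (- c * \<bar>real_of_int k\<bar>)) summable_on UNIV"
proof -
  have *: "summable (\<lambda>n::nat. exp (- c * real n))"
  proof -
    have "summable (\<lambda>n. exp (- c) ^ n)" using assms by (intro summable_geometric) simp
    then show ?thesis by (simp add: exp_of_nat_mult[symmetric] mult.commute)
  qed
  have "(\<lambda>n::nat. exp (- c * \<bar>real_of_int (int n)\<bar>)) summable_on UNIV"
    using * by (intro norm_summable_imp_summable_on) simp
  moreover have "(\<lambda>n::nat. exp (- c * \<bar>real_of_int (- 1 - int n)\<bar>)) summable_on UNIV"
  proof (intro norm_summable_imp_summable_on)
    have "summable (\<lambda>n::nat. exp (- c * real (Suc n)))" using * by (subst summable_Suc_iff)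
    then show "summable (\<lambda>n. norm (exp (- c * \<bar>real_of_int (- 1 - int n)\<bar>)))"
      by (simp add: add.commute)
  qed
  ultimately show ?thesis
    using has_sum_int_split[of "\<lambda>k. exp (- c * \<bar>real_of_int k\<bar>)"] unfolding summable_on_def by blast
qed

text \<open>It suffices that \<open>|k| - 1 <= (k + a)^2\<close>, which rests on
  \<open>m <= m^2\<close> for integers. The bound is uniform in \<open>a\<close> and serves as
  majorant in the Weierstrass test.\<close>

lemma gaussian_shift_le:
  fixes s a :: real and k :: int
  assumes "s > 0" "a \<in> {0..1}"
  shows "exp (- pi * (of_int k + a)\<^sup>2 * s) \<le> exp (pi * s) * exp (- (pi * s) * \<bar>real_of_int k\<bar>)"
proof -
  have "\<bar>real_of_int k\<bar> - 1 \<le> (of_int k + a)\<^sup>2"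
  proof (cases "k \<ge> 0")
    case True
    have "k \<le> k\<^sup>2" using True by (cases "k = 0") (auto intro: self_le_power)
    then have "real_of_int k \<le> (real_of_int k)\<^sup>2" by (simp flip: of_int_power)
    also have "\<dots> \<le> (of_int k + a)\<^sup>2" using True assms(2) by (intro power_mono) auto
    finally show ?thesis using True by simp
  next
    case False
    \<comment> \<open>Since \<open>k + a = - (m + (1 - a))\<close>, negative \<open>k\<close>
      reduces to the nonnegative case with shift \<open>1 - a\<close>.\<close>
    define m where "m = - k - 1"
    have m: "m \<ge> 0" using False by (simp add: m_def)
    have k: "k = - m - 1" by (simp add: m_def)
    have "m \<le> m\<^sup>2" using m by (cases "m = 0") (auto intro: self_le_power)
    then have "real_of_int m \<le> (real_of_int m)\<^sup>2" by (simp flip: of_int_power)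
    also have "\<dots> \<le> (m + (1 - a))\<^sup>2" using m assms(2) by (intro power_mono) auto
    also have "\<dots> = (of_int k + a)\<^sup>2" by (simp add: k power2_eq_square algebra_simps)
    finally show ?thesis using m k by simp
  qed
  then have "(pi * s) * (\<bar>real_of_int k\<bar> - 1) \<le> (pi * s) * (of_int k + a)\<^sup>2"
    using assms by (intro mult_left_mono) auto
  then show ?thesis by (simp add: exp_add[symmetric] algebra_simps)
qed

section \<open>Periodization and uniqueness of cosine coefficients\<close>

text \<open>Uniform convergence permits integration term by term; the term of index \<open>k\<close>
  contributes the integral of \<open>h\<close> over \<open>[k, k + 1]\<close>, and these intervals
  tile the line.\<close>

lemma has_integral_periodization:
  fixes h :: "real \<Rightarrow> real" and M :: "int \<Rightarrow> real"
  assumes cont: "continuous_on UNIV h" and int: "integrable lborel h"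
    and bound: "\<And>k a. a \<in> {0..1} \<Longrightarrow> \<bar>h (of_int k + a)\<bar> \<le> M k" and M: "M summable_on UNIV"
  shows "((\<lambda>a. \<Sum>\<^sub>\<infinity>k::int. h (of_int k + a)) has_integral (\<integral>x. h x \<partial>lborel)) {0..1}"
proof -
  let ?f = "\<lambda>X a. \<Sum>k\<in>X. h (of_int k + a)"
  have "uniform_limit {0..1} ?f (\<lambda>a. \<Sum>\<^sub>\<infinity>k::int. h (of_int k + a)) (finite_subsets_at_top UNIV)"
    using bound M by (intro Weierstrass_m_test_general) auto
  moreover have "continuous_on {0..1} (?f X)" for X
    by (intro continuous_intros continuous_on_compose2[OF cont]) auto
  ultimately obtain I J where I: "\<And>X. (?f X has_integral I X) {0..1}"
    and J: "((\<lambda>a. \<Sum>\<^sub>\<infinity>k::int. h (of_int k + a)) has_integral J) {0..1}"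
    and lim: "(I \<longlongrightarrow> J) (finite_subsets_at_top UNIV)"
    by (rule uniform_limit_integral[OF _ _ finite_subsets_at_top_neq_bot]) (rule that)
  have hint: "h integrable_on {a..b}" for a b
    by (intro integrable_continuous_real continuous_on_subset[OF cont]) auto
  \<comment> \<open>\<open>J\<close> is a limit over all finite index sets. Along the half-open
    windows \<open>{- n..<n}\<close> the unit intervals tile exactly
    \<open>[- n, n]\<close>.\<close>
  have "(\<lambda>n. I {- int n..<int n}) \<longlonglongrightarrow> J"
  proof (rule filterlim_compose[OF lim])
    show "filterlim (\<lambda>n. {- int n..<int n}) (finite_subsets_at_top UNIV) sequentially"
      unfolding filterlim_finite_subsets_at_top
    proof safe
      fix X :: "int set" assume X: "finite X"
      define B where "B = (\<Sum>x\<in>X. \<bar>x\<bar>) + 1"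
      have "\<bar>x\<bar> < B" if "x \<in> X" for x
        using member_le_sum[of x X abs] that X by (auto simp: B_def)
      then have "X \<subseteq> {- int n..<int n}" if "n \<ge> nat B" for n
        using that by fastforce
      then show "\<forall>\<^sub>F n in sequentially. finite {- int n..<int n} \<and> X \<subseteq> {- int n..<int n} \<and> {- int n..<int n} \<subseteq> UNIV"
        unfolding eventually_sequentially by blast
    qed
  qed
  moreover have "I {- int n..<int n} = integral {- real n..real n} h" for n
  proof -
    have piece: "((\<lambda>a. h (of_int k + a)) has_integral integral {of_int k..of_int k + 1} h) {0..1}" for k :: int
    proof -
      have "(h has_integral integral {of_int k..of_int k + 1} h) (cbox (of_int k) (of_int k + 1))"
        using hint by (auto intro: integrable_integral)
      from has_integral_affinity[OF this, of 1 "of_int k"] show ?thesis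
        by (simp add: add.commute image_affinity_atLeastAtMost_diff) 
    qed
    have "(?f {- int n..<int n} has_integral (\<Sum>k\<in>{- int n..<int n}. integral {of_int k..of_int k + 1} h)) {0..1}"
      by (intro has_integral_sum piece) auto
    then have "I {- int n..<int n} = (\<Sum>k\<in>{- int n..<int n}. integral {of_int k..of_int k + 1} h)"
      using I has_integral_unique by blast
    also have "\<dots> = integral {- real n..real n} h"
    proof (induction n)
      case (Suc n)
      \<comment> \<open>Enlarging the window adds one unit interval at each end,
        \<open>[- n - 1, - n]\<close> and \<open>[n, n + 1]\<close>.\<close>
      have "{- int (Suc n)..<int (Suc n)} = insert (- int (Suc n)) (insert (int n) {- int n..<int n})" by auto
      then have "(\<Sum>k\<in>{- int (Suc n)..<int (Suc n)}. integral {of_int k..of_int k + 1} h) =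
        integral {- real (Suc n)..- real n} h + (integral {real n..real (Suc n)} h + integral {- real n..real n} h)"
        using Suc by (simp add: algebra_simps)
      also have "integral {real n..real (Suc n)} h + integral {- real n..real n} h = integral {- real n..real (Suc n)} h"
        using Henstock_Kurzweil_Integration.integral_combine[of "- real n" "real n" "real (Suc n)" h] hint by simp
      also have "integral {- real (Suc n)..- real n} h + \<dots> = integral {- real (Suc n)..real (Suc n)} h"
        using hint by (intro Henstock_Kurzweil_Integration.integral_combine) auto
      finally show ?case .
    qed auto
    finally show ?thesis .
  qed
  moreover have "(\<lambda>n. integral {- real n..real n} h) \<longlonglongrightarrow> (\<integral>x. h x \<partial>lborel)"
  proof -
    have "(\<lambda>n. \<integral>x. indicator {- real n..real n} x *\<^sub>R h x \<partial>lborel) \<longlonglongrightarrow> (\<integral>x. h x \<partial>lborel)"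
    proof (rule integral_dominated_convergence[where w = "\<lambda>x. \<bar>h x\<bar>"])
      show "AE x in lborel. (\<lambda>n. indicator {- real n..real n} x *\<^sub>R h x) \<longlonglongrightarrow> h x"
      proof (rule AE_I2)
        fix x :: real
        obtain N :: nat where "\<bar>x\<bar> \<le> real N" using real_arch_simple by blast
        then have "eventually (\<lambda>n. indicator {- real n..real n} x *\<^sub>R h x = h x) sequentially"
          unfolding eventually_sequentially by (intro exI[of _ N]) (auto simp: indicator_def)
        then show "(\<lambda>n. indicator {- real n..real n} x *\<^sub>R h x) \<longlonglongrightarrow> h x"
          by (rule tendsto_eventually)
      qed
    qed (use int in \<open>auto simp: indicator_def\<close>)
    moreover have "(\<integral>x. indicator {- real n..real n} x *\<^sub>R h x \<partial>lborel) = integral {- real n..real n} h" for n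
      using set_borel_integral_eq_integral(2)[of "{- real n..real n}" h] integrable_mult_indicator[OF _ int]
      unfolding set_lebesgue_integral_def set_integrable_def by simp
    ultimately show ?thesis by simp
  qed
  ultimately have "J = (\<integral>x. h x \<partial>lborel)" using LIMSEQ_unique by simp
  with J show ?thesis by simp
qed

text \<open>The symmetry makes \<open>D a\<close> a continuous function of
  \<open>cos (2 * pi * a)\<close>, hence uniformly close to a polynomial in that cosine.
  \<open>D\<close> is orthogonal to all such polynomials, which forces the integral of
  \<open>D^2\<close> to vanish.\<close>

lemma even_periodic_zero_cos_coefficients:
  fixes D :: "real \<Rightarrow> real"
  assumes cont: "continuous_on {0..1} D" and sym: "\<And>a. a \<in> {0..1} \<Longrightarrow> D (1 - a) = D a"
    and zero: "\<And>n::int. integral {0..1} (\<lambda>a. D a * cos (2 * pi * of_int n * a)) = 0"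
    and a: "a \<in> {0..1}"
  shows "D a = 0"
proof -
  let ?c = "\<lambda>a. cos (2 * pi * a)"
  have ci: "(\<lambda>a. f a) integrable_on {0..1}" if "continuous_on {0..1} f" for f :: "real \<Rightarrow> real"
    using that by (rule integrable_continuous_real)
  \<comment> \<open>Each factor \<open>cos (2 * pi * a)\<close> shifts the frequency
    \<open>n\<close> by one in both directions, so the induction on \<open>j\<close> needs arbitrary
    \<open>n\<close>.\<close>
  have pow: "integral {0..1} (\<lambda>a. D a * (?c a ^ j * cos (2 * pi * of_int n * a))) = 0" for j and n :: int
  proof (induction j arbitrary: n)
    case 0 then show ?case using zero by simp
  next
    case (Suc j)
    have eq: "D a * (?c a ^ Suc j * cos (2 * pi * of_int n * a)) =
      (1/2) * (D a * (?c a ^ j * cos (2 * pi * of_int (n + 1) * a))) + (1/2) * (D a * (?c a ^ j * cos (2 * pi * of_int (n - 1) * a)))" for a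
    proof -
      have "?c a * cos (2 * pi * of_int n * a) = (1/2) * cos (2 * pi * of_int (n + 1) * a) + (1/2) * cos (2 * pi * of_int (n - 1) * a)"
        by (simp add: algebra_simps cos_add cos_diff)
      then have "D a * ?c a ^ j * (?c a * cos (2 * pi * of_int n * a)) =
        D a * ?c a ^ j * ((1/2) * cos (2 * pi * of_int (n + 1) * a) + (1/2) * cos (2 * pi * of_int (n - 1) * a))"
        by (rule arg_cong)
      then show ?thesis by (simp only: distrib_left mult_ac power_Suc)
    qed
    show ?case unfolding eq
      by (subst integral_add) (auto intro!: ci continuous_intros cont simp only: integral_mult_right Suc)
  qed
  have polyz: "integral {0..1} (\<lambda>a. D a * p (?c a)) = 0" if p: "real_polynomial_function p" for p
  proof -
    obtain b m where p_eq: "p = (\<lambda>x. \<Sum>i\<le>m. b i * x ^ i)"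
      using p unfolding real_polynomial_function_iff_sum by blast
    have "integral {0..1} (\<lambda>a. D a * p (?c a)) = integral {0..1} (\<lambda>a. \<Sum>i\<le>m. b i * (D a * (?c a ^ i * cos (2 * pi * of_int 0 * a))))"
      by (simp add: p_eq sum_distrib_left mult_ac)
    also have "\<dots> = (\<Sum>i\<le>m. integral {0..1} (\<lambda>a. b i * (D a * (?c a ^ i * cos (2 * pi * of_int 0 * a)))))"
      by (intro integral_sum) (auto intro!: ci continuous_intros cont)
    also have "\<dots> = 0" by (simp only: integral_mult_right pow) simp
    finally show ?thesis .
  qed
  \<comment> \<open>\<open>E\<close> is \<open>D\<close> in the coordinate
    \<open>u = cos (2 * pi * a)\<close>. The arccosine recovers \<open>a\<close> on
    \<open>[0, 1/2]\<close> and \<open>1 - a\<close> on the other half, where \<open>sym\<close>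
    applies.\<close>
  define E where "E u = D (arccos u / (2 * pi))" for u
  have E: "E (?c a) = D a" if a: "a \<in> {0..1}" for a
  proof (cases "a \<le> 1/2")
    case True
    have "a * (pi * 2) \<le> 1/2 * (pi * 2)" using True by (intro mult_right_mono) auto
    then have "arccos (?c a) = 2 * pi * a"
      using True a by (intro arccos_cos) (auto simp: field_simps)
    then show ?thesis by (simp add: E_def)
  next
    case False
    have "?c a = cos (2 * pi * (1 - a))"
      by (simp add: right_diff_distrib cos_diff)
    moreover have "(1 - a) * (pi * 2) \<le> 1/2 * (pi * 2)" using False by (intro mult_right_mono) auto
    then have "arccos (cos (2 * pi * (1 - a))) = 2 * pi * (1 - a)"
      using False a by (intro arccos_cos) (auto simp: field_simps)
    ultimately show ?thesis using sym[OF a] by (simp add: E_def)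
  qed
  have "arccos u / (2 * pi) \<in> {0..1}" if "u \<in> {-1..1}" for u
    using arccos_lbound[of u] arccos_ubound[of u] that pi_gt_zero by (auto simp: field_simps)
  then have contE: "continuous_on {-1..1} E" unfolding E_def
    by (intro continuous_on_compose2[OF cont] continuous_intros) auto
  define K where "K = integral {0..1} (\<lambda>a. \<bar>D a\<bar>)"
  have sq_le: "integral {0..1} (\<lambda>a. D a * D a) \<le> e * K" if e: "e > 0" for e
  proof -
    obtain p where p: "real_polynomial_function p" "\<And>x. x \<in> {-1..1} \<Longrightarrow> \<bar>E x - p x\<bar> < e"
      using Stone_Weierstrass_real_polynomial_function[OF compact_Icc contE e] by blast
    have "continuous_on UNIV p"
      using continuous_real_polymonial_function[OF p(1)] by (simp add: continuous_at_imp_continuous_on)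
    then have contp: "continuous_on {0..1} (\<lambda>a. p (?c a))"
      by (rule continuous_on_compose2) (auto intro!: continuous_intros)
    \<comment> \<open>The subtracted term integrates to 0 by \<open>polyz\<close>; what remains is
      \<open>D\<close> times the approximation error \<open>E - p\<close>, which is below
      \<open>e\<close>.\<close>
    have "integral {0..1} (\<lambda>a. D a * D a) = integral {0..1} (\<lambda>a. D a * D a - D a * p (?c a))"
      by (subst integral_diff) (auto intro!: ci continuous_intros cont contp simp: polyz[OF p(1)])
    also have "\<dots> \<le> integral {0..1} (\<lambda>a. e * \<bar>D a\<bar>)"
    proof (rule integral_le)
      fix a :: real assume a: "a \<in> {0..1}"
      have "D a * D a - D a * p (?c a) = D a * (E (?c a) - p (?c a))"
        using E[OF a] by (simp add: algebra_simps)
      also have "\<dots> \<le> \<bar>D a\<bar> * \<bar>E (?c a) - p (?c a)\<bar>"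
        by (metis abs_ge_self abs_mult)
      also have "\<dots> \<le> \<bar>D a\<bar> * e" using p(2)[of "?c a"] by (intro mult_left_mono) auto
      finally show "D a * D a - D a * p (?c a) \<le> e * \<bar>D a\<bar>" by (simp add: mult.commute)
    qed (auto intro!: ci continuous_intros cont contp)
    finally show ?thesis by (simp add: K_def)
  qed
  have "integral {0..1} (\<lambda>a. D a * D a) \<le> 0"
  proof (rule ccontr)
    assume "\<not> ?thesis"
    then have pos: "integral {0..1} (\<lambda>a. D a * D a) > 0" (is "?L > 0") by simp
    have "K \<ge> 0" unfolding K_def by (intro integral_nonneg ci continuous_intros cont) auto
    \<comment> \<open>The choice \<open>e = ?L / (K + 1)\<close> contradicts \<open>sq_le\<close>;
      adding 1 keeps the divisor positive when \<open>K = 0\<close>.\<close>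
    then have "?L / (K + 1) * K < ?L" using pos by (simp add: field_simps)
    then show False using sq_le[of "?L / (K + 1)"] pos \<open>K \<ge> 0\<close> by simp
  qed
  moreover have "integral {0..1} (\<lambda>a. D a * D a) \<ge> 0"
    by (intro integral_nonneg ci continuous_intros cont) auto
  ultimately have "((\<lambda>a. D a * D a) has_integral 0) (cbox 0 1)"
    using integrable_integral[OF ci[of "\<lambda>a. D a * D a"]] cont by (simp add: continuous_on_mult)
  then have "D a * D a = 0"
    using a cont by (intro has_integral_0_cbox_imp_0[of 0 1 "\<lambda>a. D a * D a" a]) (auto intro!: continuous_intros)
  then show ?thesis by simp
qed

lemma has_integral_cos_2pi_int:
  "((\<lambda>a. cos (2 * pi * of_int n * a)) has_integral (if n = 0 then 1 else 0)) {0..1}" for n :: int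
proof (cases "n = 0")
  case True
  then show ?thesis using has_integral_const_real[of "1::real" 0 1] by simp
next
  case False
  have "((\<lambda>a. cos (2 * pi * of_int n * a)) has_integral
      (sin (2 * pi * of_int n * 1) / (2 * pi * of_int n) - sin (2 * pi * of_int n * 0) / (2 * pi * of_int n))) {0..1}"
    using False by (intro fundamental_theorem_of_calculus)
      (auto intro!: derivative_eq_intros simp flip: has_real_derivative_iff_has_vector_derivative)
  moreover have "sin (2 * pi * of_int n) = 0"
    using sin_int_2pin[of n] by simp
  ultimately show ?thesis using False by simp
qed

lemma summable_on_gaussian_int:
  fixes s :: real
  assumes "s > 0"
  shows "(\<lambda>k::int. exp (pi * s) * exp (- (pi * s) * \<bar>real_of_int k\<bar>)) summable_on UNIV"
  using assms by (intro summable_on_cmult_right summable_on_exp_abs_int) simp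

text \<open>Both sides are even, 1-periodic, continuous functions of
  the shift with the same Fourier coefficients.\<close>

lemma poisson_summation_gaussian:
  fixes s a :: real
  assumes s: "s > 0" and a: "a \<in> {0..1}"
  shows "(\<Sum>\<^sub>\<infinity>k::int. exp (- pi * (of_int k + a)\<^sup>2 * s)) =
    (\<Sum>\<^sub>\<infinity>k::int. exp (- pi * (of_int k)\<^sup>2 / s) * cos (2 * pi * of_int k * a)) / sqrt s"
proof -
  define G where "G a = (\<Sum>\<^sub>\<infinity>k::int. exp (- pi * (of_int k + a)\<^sup>2 * s))" for a
  define H where "H a = (\<Sum>\<^sub>\<infinity>k::int. exp (- pi * (of_int k)\<^sup>2 / s) * cos (2 * pi * of_int k * a))" for a
  define D where "D a = G a - H a / sqrt s" for a
  let ?M = "\<lambda>s k. exp (pi * s) * exp (- (pi * s) * \<bar>real_of_int k\<bar>)"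
  have boundG: "\<bar>exp (- pi * (of_int k + a)\<^sup>2 * s)\<bar> \<le> ?M s k" if "a \<in> {0..1}" for a k
    using gaussian_shift_le[OF s that, of k] by simp
  have boundH: "\<bar>exp (- pi * (of_int k)\<^sup>2 / s) * cos (2 * pi * of_int k * a)\<bar> \<le> ?M (1/s) k" for a k
  proof -
    have "\<bar>exp (- pi * (of_int k)\<^sup>2 / s) * cos (2 * pi * of_int k * a)\<bar> \<le> exp (- pi * (of_int k)\<^sup>2 / s)"
      by (simp add: abs_mult mult_left_le)
    also have "\<dots> \<le> ?M (1/s) k" using gaussian_shift_le[of "1/s" 0 k] s by simp
    finally show ?thesis .
  qed
  have ulG: "uniform_limit {0..1} (\<lambda>X a. \<Sum>k\<in>X. exp (- pi * (of_int k + a)\<^sup>2 * s)) G (finite_subsets_at_top UNIV)"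
    unfolding G_def using boundG summable_on_gaussian_int[OF s] by (intro Weierstrass_m_test_general) auto
  have ulH: "uniform_limit {0..1} (\<lambda>X a. \<Sum>k\<in>X. exp (- pi * (of_int k)\<^sup>2 / s) * cos (2 * pi * of_int k * a)) H (finite_subsets_at_top UNIV)"
    unfolding H_def using boundH summable_on_gaussian_int[of "1/s"] s
    by (intro Weierstrass_m_test_general[where M = "?M (1/s)"]) auto
  have contG: "continuous_on {0..1} G"
    by (rule uniform_limit_theorem[OF _ ulG]) (auto intro!: always_eventually continuous_intros)
  have contH: "continuous_on {0..1} H"
    by (rule uniform_limit_theorem[OF _ ulH]) (auto intro!: always_eventually continuous_intros)
  have coeffG: "((\<lambda>a. G a * cos (2 * pi * of_int n * a)) has_integral (exp (- pi * (of_int n)\<^sup>2 / s) / sqrt s)) {0..1}" for n :: int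
  proof -
    \<comment> \<open>The cosine is unchanged by integer shifts, so
      \<open>G a * cos (2 * pi * n * a)\<close> is the periodization of \<open>h\<close>, and its
      integral unfolds to a Fourier integral over the line.\<close>
    define h where "h x = exp (- pi * x\<^sup>2 * s) * cos (2 * pi * of_int n * x)" for x
    have cos_eq: "cos (2 * pi * of_int n * (of_int k + a)) = cos (2 * pi * of_int n * a)" for k :: int and a
    proof -
      have "2 * pi * of_int n * (of_int k + a) = 2 * pi * of_int n * a + 2 * pi * of_int (n * k)"
        by (simp add: algebra_simps)
      then show ?thesis by (simp add: cos_add del: of_int_mult)
    qed
    have "has_bochner_integral lborel h (exp (- pi * (of_int n)\<^sup>2 / s) / sqrt s)"
      unfolding h_def by (rule has_bochner_integral_gaussian_cos[OF s])
    then have h: "integrable lborel h" "(\<integral>x. h x \<partial>lborel) = exp (- pi * (of_int n)\<^sup>2 / s) / sqrt s"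
      by (auto simp: has_bochner_integral_iff)
    have bound: "\<bar>h (of_int k + a)\<bar> \<le> ?M s k" if "a \<in> {0..1}" for a k
    proof -
      have "\<bar>h (of_int k + a)\<bar> \<le> exp (- pi * (of_int k + a)\<^sup>2 * s)"
        by (simp add: h_def abs_mult mult_left_le)
      also have "\<dots> \<le> ?M s k" using boundG[OF that, of k] by simp
      finally show ?thesis .
    qed
    have "((\<lambda>a. \<Sum>\<^sub>\<infinity>k::int. h (of_int k + a)) has_integral (\<integral>x. h x \<partial>lborel)) {0..1}"
      using bound summable_on_gaussian_int[OF s]
      by (intro has_integral_periodization h(1)) (auto simp: h_def intro!: continuous_intros)
    moreover have "(\<Sum>\<^sub>\<infinity>k::int. h (of_int k + a)) = G a * cos (2 * pi * of_int n * a)" for a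
      by (simp only: h_def cos_eq G_def infsum_cmult_left')
    ultimately show ?thesis using h by simp
  qed
  have coeffH: "((\<lambda>a. H a * cos (2 * pi * of_int n * a)) has_integral exp (- pi * (of_int n)\<^sup>2 / s)) {0..1}" for n :: int
  proof -
    let ?t = "\<lambda>k a. exp (- pi * (of_int k)\<^sup>2 / s) * cos (2 * pi * of_int k * a) * cos (2 * pi * of_int n * a)"
    let ?d = "\<lambda>k::int. if k = 0 then 1 else (0::real)"
    have "uniform_limit {0..1} (\<lambda>X a. \<Sum>k\<in>X. ?t k a) (\<lambda>a. \<Sum>\<^sub>\<infinity>k. ?t k a) (finite_subsets_at_top UNIV)"
    proof (rule Weierstrass_m_test_general)
      fix k :: int and a :: real
      have "\<bar>?t k a\<bar> \<le> \<bar>exp (- pi * (of_int k)\<^sup>2 / s) * cos (2 * pi * of_int k * a)\<bar>"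
        by (simp add: abs_mult mult_left_le)
      also have "\<dots> \<le> ?M (1/s) k" by (rule boundH)
      finally show "norm (?t k a) \<le> ?M (1/s) k" by simp
    qed (use s in \<open>intro summable_on_gaussian_int, simp\<close>)
    then have "uniform_limit {0..1} (\<lambda>X a. \<Sum>k\<in>X. ?t k a) (\<lambda>a. H a * cos (2 * pi * of_int n * a)) (finite_subsets_at_top UNIV)"
      by (simp only: H_def infsum_cmult_left')
    moreover have "continuous_on {0..1} (\<lambda>a. \<Sum>k\<in>X. ?t k a)" for X
      by (intro continuous_intros)
    ultimately obtain I J where I: "\<And>X. ((\<lambda>a. \<Sum>k\<in>X. ?t k a) has_integral I X) {0..1}"
      and J: "((\<lambda>a. H a * cos (2 * pi * of_int n * a)) has_integral J) {0..1}"
      and lim: "(I \<longlongrightarrow> J) (finite_subsets_at_top UNIV)"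
      by (rule uniform_limit_integral[OF _ _ finite_subsets_at_top_neq_bot]) (rule that)
    \<comment> \<open>By the product-to-sum formula and orthogonality, the term of index
      \<open>k\<close> integrates to 0 unless \<open>k = n\<close> or
      \<open>k = - n\<close>.\<close>
    define v where "v k = exp (- pi * (of_int k)\<^sup>2 / s) * (?d (k + n) / 2 + ?d (k - n) / 2)" for k :: int
    have "((\<lambda>a. ?t k a) has_integral v k) {0..1}" for k
    proof -
      have "((\<lambda>a. exp (- pi * (of_int k)\<^sup>2 / s) * (cos (2 * pi * of_int (k + n) * a) / 2 + cos (2 * pi * of_int (k - n) * a) / 2)) has_integral v k) {0..1}"
        unfolding v_def by (intro has_integral_mult_right has_integral_add has_integral_divide has_integral_cos_2pi_int)
      moreover have "exp (- pi * (of_int k)\<^sup>2 / s) * (cos (2 * pi * of_int (k + n) * a) / 2 + cos (2 * pi * of_int (k - n) * a) / 2) = ?t k a" for a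
        by (simp only: of_int_add of_int_diff distrib_left distrib_right left_diff_distrib
              right_diff_distrib cos_add cos_diff) (simp add: field_simps)
      ultimately show ?thesis by (simp only:)
    qed
    then have "((\<lambda>a. \<Sum>k\<in>X. ?t k a) has_integral sum v X) {0..1}" if "finite X" for X
      using that by (intro has_integral_sum) auto
    then have "I X = sum v X" if "finite X" for X
      using I that has_integral_unique by blast
    then have "(sum v \<longlongrightarrow> J) (finite_subsets_at_top UNIV)"
      by (intro Lim_transform_eventually[OF lim] eventually_finite_subsets_at_top_weakI) auto
    then have "(v has_sum J) UNIV" by (simp add: has_sum_def)
    moreover have "(v has_sum exp (- pi * (of_int n)\<^sup>2 / s)) UNIV"
    \<comment> \<open>For \<open>n \<noteq> 0\<close> the indices \<open>n\<close> and
      \<open>- n\<close> contribute half each; for \<open>n = 0\<close> the set is a singleton and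
      both halves fall on the same index.\<close>
    proof (rule has_sum_finite_neutralI[of "{n, - n}"])
      show "exp (- pi * (of_int n)\<^sup>2 / s) = sum v {n, - n}"
        by (cases "n = 0") (auto simp: v_def)
    qed (auto simp: v_def)
    ultimately show ?thesis using J has_sum_unique by blast
  qed
  have symG: "G (1 - a) = G a" for a
  proof -
    \<comment> \<open>This reindexing sends \<open>k + (1 - a)\<close> to
      \<open>- (k + a)\<close>.\<close>
    have "bij (\<lambda>k::int. - k - 1)" by (rule bij_betwI[where g = "\<lambda>k. - k - 1"]) auto
    from infsum_reindex_bij_betw[OF this, of "\<lambda>k. exp (- pi * (of_int k + (1 - a))\<^sup>2 * s)"]
    have "G (1 - a) = (\<Sum>\<^sub>\<infinity>k::int. exp (- pi * (of_int (- k - 1) + (1 - a))\<^sup>2 * s))"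
      by (simp add: G_def)
    also have "\<dots> = G a"
      unfolding G_def by (intro infsum_cong) (simp add: power2_eq_square algebra_simps)
    finally show ?thesis .
  qed
  have symH: "H (1 - a) = H a" for a
  proof -
    have "cos (2 * pi * of_int k * (1 - a)) = cos (2 * pi * of_int k * a)" for k :: int
    proof -
      have "2 * pi * of_int k * (1 - a) = 2 * pi * of_int k - 2 * pi * of_int k * a"
        by (simp add: algebra_simps)
      then show ?thesis by (simp add: cos_diff del: of_int_mult)
    qed
    then show ?thesis by (simp add: H_def)
  qed
  have "D a = 0"
  proof (rule even_periodic_zero_cos_coefficients[OF _ _ _ a])
    show "continuous_on {0..1} D"
      unfolding D_def using s by (intro continuous_intros contG contH) auto
    show "D (1 - a) = D a" for a by (simp add: D_def symG symH)
    show "integral {0..1} (\<lambda>a. D a * cos (2 * pi * of_int n * a)) = 0" for n :: int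
    proof -
      have "((\<lambda>a. G a * cos (2 * pi * of_int n * a) - H a * cos (2 * pi * of_int n * a) / sqrt s) has_integral
        (exp (- pi * (of_int n)\<^sup>2 / s) / sqrt s - exp (- pi * (of_int n)\<^sup>2 / s) / sqrt s)) {0..1}"
        by (intro has_integral_diff has_integral_divide coeffG coeffH)
      then show ?thesis by (intro integral_unique) (simp add: D_def algebra_simps)
    qed
  qed
  then show ?thesis by (simp add: D_def G_def H_def)
qed

subsection \<open>Power series in \<open>q = exp (- y)\<close>\<close>

text \<open>The theta functions are used at \<open>y = pi * s\<close>. In the variable
  \<open>y\<close>, differentiation multiplies the coefficient of index \<open>n\<close> by
  \<open>- n\<close>, so derivatives are again series of this shape.\<close>

definition qseries :: "(nat \<Rightarrow> real) \<Rightarrow> real \<Rightarrow> real" where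
  "qseries c y = (\<Sum>n. c n * exp (- y) ^ n)"

definition conv_unit_disc :: "(nat \<Rightarrow> real) \<Rightarrow> bool" where
  "conv_unit_disc c \<longleftrightarrow> (\<forall>x. \<bar>x\<bar> < 1 \<longrightarrow> summable (\<lambda>n. c n * x ^ n))"

lemma conv_unit_disc_bounded:
  assumes "\<And>n. \<bar>c n\<bar> \<le> B"
  shows "conv_unit_disc c"
  unfolding conv_unit_disc_def
proof safe
  fix x :: real assume "\<bar>x\<bar> < 1"
  then have "summable (\<lambda>n. B * \<bar>x\<bar> ^ n)" by (intro summable_mult summable_geometric) simp
  then show "summable (\<lambda>n. c n * x ^ n)"
    by (rule summable_comparison_test'[where N = 0])
       (simp add: abs_mult power_abs mult_right_mono assms)
qed

text \<open>Termwise differentiation followed by multiplication by \<open>x\<close>. It makes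
  \<open>conv_unit_disc\<close> closed under \<open>c n -> n * c n\<close>, which covers first and
  second derivatives.\<close>

lemma sums_index_times:
  assumes "conv_unit_disc c" "\<bar>x\<bar> < 1"
  shows "(\<lambda>n. real n * c n * x ^ n) sums (x * (\<Sum>n. diffs c n * x ^ n))"
proof -
  have "summable (\<lambda>n. diffs c n * x ^ n)"
    by (rule termdiff_converges[of x 1]) (use assms in \<open>auto simp: conv_unit_disc_def\<close>)
  then have "(\<lambda>n. x * (diffs c n * x ^ n)) sums (x * (\<Sum>n. diffs c n * x ^ n))"
    by (intro sums_mult summable_sums)
  then have "(\<lambda>n. real (Suc n) * c (Suc n) * x ^ Suc n) sums (x * (\<Sum>n. diffs c n * x ^ n))"
    by (simp add: diffs_def mult_ac)
  then show ?thesis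
    using sums_Suc_iff[of "\<lambda>n. real n * c n * x ^ n"] by simp
qed

lemma conv_unit_disc_index_times:
  assumes "conv_unit_disc c"
  shows "conv_unit_disc (\<lambda>n. real n * c n)"
  using sums_index_times[OF assms] unfolding conv_unit_disc_def by (blast intro: sums_summable)

lemma summable_qseries:
  assumes "conv_unit_disc c" "y > 0"
  shows "summable (\<lambda>n. c n * exp (- y) ^ n)"
  using assms unfolding conv_unit_disc_def by simp

lemma DERIV_qseries:
  assumes "conv_unit_disc c" "y > 0"
  shows "(qseries c has_real_derivative - qseries (\<lambda>n. real n * c n) y) (at y)"
proof -
  have "((\<lambda>z. \<Sum>n. c n * z ^ n) has_field_derivative (\<Sum>n. diffs c n * exp (- y) ^ n)) (at (exp (- y)))"
    by (rule termdiffs_strong'[of 1]) (use assms in \<open>auto simp: conv_unit_disc_def\<close>)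
  then have "((\<lambda>y. \<Sum>n. c n * exp (- y) ^ n) has_real_derivative
      (\<Sum>n. diffs c n * exp (- y) ^ n) * (- exp (- y))) (at y)"
    by (rule DERIV_chain2) (auto intro!: derivative_eq_intros)
  moreover have "qseries (\<lambda>n. real n * c n) y = exp (- y) * (\<Sum>n. diffs c n * exp (- y) ^ n)"
    unfolding qseries_def by (rule sums_unique[symmetric], rule sums_index_times) (use assms in auto)
  ultimately show ?thesis unfolding qseries_def[abs_def] by (simp add: mult.commute)
qed

lemma qseries_pos:
  assumes "conv_unit_disc c" "y > 0" "\<And>n. c n \<ge> 0" "c 0 > 0"
  shows "qseries c y > 0"
  unfolding qseries_def
  by (rule suminf_pos2[of _ 0]) (use assms summable_qseries in auto)

section \<open>Estimates for y at least 3\<close>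

lemma exp_neg_le: "exp (- y) \<le> 1 / 16" if "y \<ge> 3" for y :: real
proof -
  \<comment> \<open>\<open>13 / 8 = 1 + 1 / 2 + 1 / 8\<close> is the quadratic Taylor bound for
    \<open>exp (1 / 2)\<close>, and its sixth power is about 18.4.\<close>
  have "(16 :: real) \<le> (13 / 8) ^ 6" by (simp add: power_divide)
  also have "\<dots> \<le> exp (1 / 2 :: real) ^ 6"
    using exp_lower_Taylor_quadratic[of "1 / 2"] by (intro power_mono) (auto simp: power2_eq_square)
  also have "\<dots> = exp 3" by (simp add: exp_of_nat_mult[symmetric])
  also have "\<dots> \<le> exp y" using that by simp
  finally have "16 \<le> exp y" .
  then show ?thesis by (simp add: exp_minus field_simps)
qed

text \<open>For \<open>n \<ge> 2\<close> one has \<open>n^2 <= 4^(n - 1)\<close>, and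
  \<open>4 * q <= 1 / 4\<close>, so the tail is below a geometric series of ratio 1/4. The
  coefficients 0 and 1 enter exactly and are therefore exempt from the bound.\<close>

lemma qseries_linear_approx:
  assumes conv: "conv_unit_disc c" and y: "y \<ge> 3" and c: "\<And>n. \<bar>c n\<bar> \<le> B * (real n)\<^sup>2 \<or> n < 2"
  shows "\<bar>qseries c y - c 0 - c 1 * exp (- y)\<bar> \<le> B * exp (- y) / 3"
proof -
  define q where "q = exp (- y)"
  have q: "0 < q" "q \<le> 1 / 16" using exp_neg_le[OF y] by (auto simp: q_def)
  have sm: "summable (\<lambda>n. c n * q ^ n)" unfolding q_def by (rule summable_qseries) (use conv y in auto)
  have B: "B \<ge> 0" using c[of 2] by simp
  have pow: "(real (n + 2))\<^sup>2 \<le> 4 ^ (n + 1)" for n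
  proof (induction n)
    case (Suc n)
    have "(real (Suc n + 2))\<^sup>2 \<le> (2 * real (n + 2))\<^sup>2" by (intro power_mono) auto
    also have "\<dots> = 4 * (real (n + 2))\<^sup>2" by (simp only: power_mult_distrib) simp
    also have "\<dots> \<le> 4 ^ (Suc n + 1)" using Suc by simp
    finally show ?case .
  qed simp
  have term_le: "\<bar>c (n + 2) * q ^ (n + 2)\<bar> \<le> B * q / 4 * (1 / 4) ^ n" for n
  proof -
    have "\<bar>c (n + 2)\<bar> \<le> B * (real (n + 2))\<^sup>2" using c[of "n + 2"] by simp
    also have "\<dots> \<le> B * 4 ^ (n + 1)" using pow[of n] B by (intro mult_left_mono)
    finally have "\<bar>c (n + 2)\<bar> * q ^ (n + 2) \<le> B * 4 ^ (n + 1) * q ^ (n + 2)"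
      using q by (intro mult_right_mono) auto
    also have "\<dots> = B * (q * (4 * q) ^ (n + 1))" by (simp add: power_mult_distrib)
    also have "\<dots> \<le> B * (q * (1 / 4) ^ (n + 1))" using q B by (intro mult_left_mono power_mono) auto
    finally show ?thesis using q by (simp add: abs_mult)
  qed
  have geo: "(\<lambda>n. B * q / 4 * (1 / 4) ^ n) sums (B * q / 3)"
    using sums_mult[OF geometric_sums[of "1 / 4 :: real"], of "B * q / 4"] by simp
  have "qseries c y - c 0 - c 1 * q = (\<Sum>n. c (n + 2) * q ^ (n + 2))"
    using suminf_split_initial_segment[OF sm, of 2] by (simp add: qseries_def q_def numeral_2_eq_2)
  also have "\<bar>\<dots>\<bar> \<le> (\<Sum>n. B * q / 4 * (1 / 4) ^ n)"
    using norm_suminf_le[of "\<lambda>n. c (n + 2) * q ^ (n + 2)" "\<lambda>n. B * q / 4 * (1 / 4) ^ n"]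
      term_le sums_summable[OF geo] by simp
  also have "\<dots> = B * q / 3" using geo sums_unique by metis
  finally show ?thesis by (simp add: q_def)
qed

section \<open>Logarithmic derivatives\<close>

text \<open>This is minus the derivative of \<open>ln (qseries c y)\<close> with respect to
  \<open>ln y\<close>; the sign comes from \<open>exp (- y)\<close>. Monotonicity of
  \<open>qlogd\<close> thus expresses convexity or concavity in \<open>ln y\<close>.\<close>

definition qlogd :: "(nat \<Rightarrow> real) \<Rightarrow> real \<Rightarrow> real" where
  "qlogd c y = y * qseries (\<lambda>n. real n * c n) y / qseries c y"

lemma DERIV_qlogd:
  assumes "conv_unit_disc c" "y > 0" "qseries c y \<noteq> 0"
  shows "(qlogd c has_real_derivative
     (qseries (\<lambda>n. real n * c n) y - y * qseries (\<lambda>n. real n * (real n * c n)) y) / qseries c y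
      + y * (qseries (\<lambda>n. real n * c n) y / qseries c y)\<^sup>2) (at y)"
proof -
  note 1 = conv_unit_disc_index_times[OF assms(1)]
  show ?thesis unfolding qlogd_def[abs_def]
    by (rule derivative_eq_intros DERIV_qseries[OF assms(1,2)] DERIV_qseries[OF 1 assms(2)] refl assms(3))+
       (use assms(3) in \<open>simp add: field_simps power2_eq_square\<close>)
qed

lemma DERIV_ln_qseries:
  assumes "conv_unit_disc c" "s > 0" "qseries c (pi * s) > 0"
  shows "((\<lambda>s. ln (qseries c (pi * s))) has_real_derivative - qlogd c (pi * s) / s) (at s)"
proof -
  have "((\<lambda>s. qseries c (pi * s)) has_real_derivative - qseries (\<lambda>n. real n * c n) (pi * s) * pi) (at s)"
    by (rule DERIV_chain2[OF DERIV_qseries]) (use assms in \<open>auto intro!: derivative_eq_intros\<close>)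
  then have "((\<lambda>s. ln (qseries c (pi * s))) has_real_derivative
      1 / qseries c (pi * s) * (- qseries (\<lambda>n. real n * c n) (pi * s) * pi)) (at s)"
    by (intro DERIV_chain2[OF DERIV_ln_divide]) (use assms in auto)
  then show ?thesis using assms by (simp add: qlogd_def mult.commute)
qed

section \<open>Convexity from a reflection formula\<close>

text \<open>In the variable \<open>ln s\<close> the assumptions say that \<open>F\<close> and \<open>G\<close> are convex on the positive half-line
  and that \<open>F\<close> is, up to a linear term, the mirror image of \<open>G\<close>; so \<open>F\<close> is convex on the whole line.\<close>

lemma midpoint_le_of_reflection:
  fixes F G F' G' :: "real \<Rightarrow> real"
  assumes F: "\<And>s. s > 0 \<Longrightarrow> (F has_real_derivative F' s) (at s)"
    and G: "\<And>s. s > 0 \<Longrightarrow> (G has_real_derivative G' s) (at s)"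
    and refl: "\<And>s. s > 0 \<Longrightarrow> F s = G (1 / s) + p * ln s"
    and monoF: "\<And>s t. 1 \<le> s \<Longrightarrow> s \<le> t \<Longrightarrow> s * F' s \<le> t * F' t"
    and monoG: "\<And>s t. 1 \<le> s \<Longrightarrow> s \<le> t \<Longrightarrow> s * G' s \<le> t * G' t"
    and r: "r > 0" and s: "s > 0"
  shows "2 * F r \<le> F (r * s) + F (r / s)"
proof -
  \<comment> \<open>Differentiating the reflection formula transfers monotonicity of
    \<open>s * G' s\<close> on \<open>[1, \<infinity>)\<close> to monotonicity of
    \<open>s * F' s\<close> on \<open>(0, 1]\<close>.\<close>
  have F'_eq: "s * F' s = p - (1 / s) * G' (1 / s)" if s: "s > 0" for s
  proof -
    have "((\<lambda>s. G (1 / s)) has_real_derivative G' (1 / s) * (- 1 / s\<^sup>2)) (at s)"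
      by (rule DERIV_chain2[OF G]) (use s in \<open>auto intro!: derivative_eq_intros simp: power2_eq_square\<close>)
    then have "((\<lambda>s. G (1 / s) + p * ln s) has_real_derivative G' (1 / s) * (- 1 / s\<^sup>2) + p * (1 / s)) (at s)"
      by (intro DERIV_add DERIV_cmult DERIV_ln_divide s)
    then have "(F has_real_derivative G' (1 / s) * (- 1 / s\<^sup>2) + p * (1 / s)) (at s)"
      by (rule has_field_derivative_transform_within_open[where S = "{0<..}"]) (use s refl in auto)
    then have "F' s = G' (1 / s) * (- 1 / s\<^sup>2) + p * (1 / s)"
      using F[OF s] DERIV_unique by blast
    then show ?thesis using s by (simp add: field_simps power2_eq_square)
  qed
  have mono_low: "s * F' s \<le> t * F' t" if "0 < s" "s \<le> t" "t \<le> 1" for s t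
    using monoG[of "1 / t" "1 / s"] that by (simp add: F'_eq field_simps)
  \<comment> \<open>Arguments on opposite sides of 1 are compared through the value at 1.\<close>
  have mono: "s * F' s \<le> t * F' t" if "0 < s" "s \<le> t" for s t
  proof (cases "t \<le> 1 \<or> 1 \<le> s")
    case True
    then show ?thesis using mono_low monoF that by blast
  next
    case False
    then show ?thesis using mono_low[of s 1] monoF[of 1 t] that by linarith
  qed
  \<comment> \<open>With \<open>phi x = x * F' x\<close>, the derivative of
    \<open>F (r * x) + F (r / x)\<close> is \<open>(phi (r * x) - phi (r / x)) / x\<close>, which is
    nonnegative for \<open>x \<ge> 1\<close>. The case \<open>s < 1\<close> follows by exchanging
    \<open>s\<close> and \<open>1 / s\<close>.\<close>
  have ge1: "2 * F r \<le> F (r * s) + F (r / s)" if s: "s \<ge> 1" for s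
  proof -
    let ?H = "\<lambda>s. F (r * s) + F (r / s)"
    have "?H 1 \<le> ?H s"
    proof (rule DERIV_nonneg_imp_nondecreasing[OF s])
      fix x :: real assume x: "1 \<le> x" "x \<le> s"
      have "(?H has_real_derivative F' (r * x) * r + F' (r / x) * (- r / x\<^sup>2)) (at x)"
        by (intro DERIV_add DERIV_chain2[OF F])
           (use x r in \<open>auto intro!: derivative_eq_intros simp: power2_eq_square\<close>)
      moreover have "F' (r * x) * r + F' (r / x) * (- r / x\<^sup>2) \<ge> 0"
      proof -
        have "r / x \<le> r * x"
          using x r mult_mono[of 1 x 1 x] by (simp add: field_simps)
        then have "(r / x) * F' (r / x) \<le> (r * x) * F' (r * x)" using x r by (intro mono) auto
        then have "0 \<le> ((r * x) * F' (r * x) - (r / x) * F' (r / x)) / x" using x by simp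
        also have "\<dots> = F' (r * x) * r + F' (r / x) * (- r / x\<^sup>2)"
          using x by (simp add: field_simps power2_eq_square)
        finally show ?thesis .
      qed
      ultimately show "\<exists>D. (?H has_real_derivative D) (at x) \<and> 0 \<le> D" by blast
    qed
    then show ?thesis by simp
  qed
  show ?thesis
  proof (cases "s \<ge> 1")
    case True
    then show ?thesis by (rule ge1)
  next
    case False
    then show ?thesis using ge1[of "1 / s"] s by (simp add: add.commute)
  qed
qed

subsection \<open>Theta functions\<close>

text \<open>The number of integers whose square is \<open>n\<close>: the first indicator accounts
  for \<open>k \<ge> 0\<close>, the second for \<open>k < 0\<close>.\<close>

definition square_coeff :: "nat \<Rightarrow> real" where
  "square_coeff n = indicator (range (\<lambda>k. k\<^sup>2)) n + indicator (range (\<lambda>k. (Suc k)\<^sup>2)) n"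

text \<open>Since \<open>(k + 1 / 2)^2 = k * (k + 1) + 1 / 4\<close>, taking \<open>q^(1/4)\<close>
  out of \<open>theta2\<close> leaves these integer exponents. Negative \<open>k\<close> repeat
  them, which gives the factor 2 in \<open>theta2_qseries\<close>.\<close>

definition oblong_coeff :: "nat \<Rightarrow> real" where
  "oblong_coeff = indicator (range (\<lambda>k. k * Suc k))"

text \<open>The sign \<open>(- 1)^k\<close> is written as a cosine to match Poisson summation at
  shift 1/2.\<close>

definition theta4 :: "real \<Rightarrow> real" where
  "theta4 s = (\<Sum>\<^sub>\<infinity>k::int. exp (- pi * (of_int k)\<^sup>2 * s) * cos (pi * of_int k))"

definition theta2 :: "real \<Rightarrow> real" where
  "theta2 s = (\<Sum>\<^sub>\<infinity>k::int. exp (- pi * (of_int k + 1 / 2)\<^sup>2 * s))"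

lemma square_coeff_0 [simp]: "square_coeff 0 = 1"
  by (auto simp: square_coeff_def indicator_def image_iff)

lemma square_coeff_1 [simp]: "square_coeff (Suc 0) = 2"
proof -
  have "Suc 0 \<in> range (\<lambda>k. k\<^sup>2)" by (rule image_eqI[of _ _ 1]) auto
  moreover have "Suc 0 \<in> range (\<lambda>k. (Suc k)\<^sup>2)" by (rule image_eqI[of _ _ 0]) auto
  ultimately show ?thesis by (simp add: square_coeff_def)
qed

lemma square_coeff_bounds: "0 \<le> square_coeff n" "square_coeff n \<le> 2"
  by (auto simp: square_coeff_def indicator_def)

lemma oblong_coeff_0 [simp]: "oblong_coeff 0 = 1"
  by (auto simp: oblong_coeff_def indicator_def image_iff)

lemma oblong_coeff_1 [simp]: "oblong_coeff (Suc 0) = 0"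
proof -
  have "Suc 0 \<noteq> k * Suc k" for k by (cases k) auto
  then show ?thesis by (auto simp: oblong_coeff_def indicator_def)
qed

lemma oblong_coeff_bounds: "0 \<le> oblong_coeff n" "oblong_coeff n \<le> 1"
  by (auto simp: oblong_coeff_def indicator_def)

lemma conv_square_coeff: "conv_unit_disc square_coeff"
  by (rule conv_unit_disc_bounded[of _ 2]) (simp add: square_coeff_bounds)

lemma conv_alt_square_coeff: "conv_unit_disc (\<lambda>n. (- 1) ^ n * square_coeff n)"
  by (rule conv_unit_disc_bounded[of _ 2]) (simp add: abs_mult square_coeff_bounds)

lemma conv_oblong_coeff: "conv_unit_disc oblong_coeff"
  by (rule conv_unit_disc_bounded[of _ 1]) (simp add: oblong_coeff_bounds)

section \<open>Theta functions as power series in q\<close>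

lemma has_sum_power_subseq:
  fixes g :: "nat \<Rightarrow> nat" and x :: real
  assumes "strict_mono g" "\<bar>x\<bar> < 1"
  shows "((\<lambda>n. x ^ g n) has_sum (\<Sum>n. indicator (range g) n * x ^ n)) UNIV"
proof -
  let ?f = "\<lambda>n. indicator (range g) n * x ^ n"
  have "summable (\<lambda>n. norm (?f n))"
  proof (rule summable_comparison_test'[where N = 0])
    show "summable (\<lambda>n. \<bar>x\<bar> ^ n)" using assms by (intro summable_geometric) simp
  qed (simp add: indicator_def power_abs)
  then have "(?f has_sum (\<Sum>n. ?f n)) UNIV"
    by (intro norm_summable_imp_has_sum summable_sums) (auto intro: summable_norm_cancel)
  also have "?this \<longleftrightarrow> ((\<lambda>n. x ^ n) has_sum (\<Sum>n. ?f n)) (range g)"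
    by (rule has_sum_cong_neutral) auto
  also have "\<dots> \<longleftrightarrow> (((\<lambda>n. x ^ n) \<circ> g) has_sum (\<Sum>n. ?f n)) UNIV"
    by (rule has_sum_reindex) (use assms strict_mono_imp_inj_on in auto)
  finally show ?thesis by (simp add: o_def)
qed

text \<open>\<open>e = 1\<close> yields \<open>theta3\<close> and \<open>e = - 1\<close> yields
  \<open>theta4\<close>. As \<open>n^2\<close> and \<open>n\<close> have the same parity,
  \<open>e ^ n\<^sup>2 = e ^ n\<close>, so the sign is absorbed by evaluating one series at
  \<open>x = e * q\<close>.\<close>

lemma has_sum_signed_theta:
  fixes e s :: real
  assumes e: "\<bar>e\<bar> = 1" and s: "s > 0"
  shows "((\<lambda>k::int. exp (- pi * (of_int k)\<^sup>2 * s) * e ^ nat \<bar>k\<bar>) has_sum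
            qseries (\<lambda>n. e ^ n * square_coeff n) (pi * s)) UNIV"
proof -
  define x where "x = e * exp (- (pi * s))"
  have x: "\<bar>x\<bar> < 1" using e s by (simp add: x_def abs_mult)
  have sm: "summable (\<lambda>n. indicator A n * x ^ n)" for A
    by (rule summable_comparison_test'[OF summable_geometric[of "\<bar>x\<bar>"], where N = 0])
       (use x in \<open>auto simp: indicator_def power_abs\<close>)
  have "e ^ n\<^sup>2 = e ^ n" for n
    using e by (cases "even n") (auto simp: abs_if minus_one_power_iff split: if_splits)
  then have pw: "x ^ n\<^sup>2 = exp (- pi * (real n)\<^sup>2 * s) * e ^ n" for n
    by (simp add: x_def power_mult_distrib exp_of_nat_mult[symmetric] mult_ac)
  have "strict_mono (\<lambda>n::nat. n\<^sup>2)" "strict_mono (\<lambda>n::nat. (Suc n)\<^sup>2)"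
    by (auto simp: strict_mono_def intro!: power_strict_mono)
  then have h: "((\<lambda>n. x ^ n\<^sup>2) has_sum (\<Sum>n. indicator (range (\<lambda>k. k\<^sup>2)) n * x ^ n)) UNIV"
    "((\<lambda>n. x ^ (Suc n)\<^sup>2) has_sum (\<Sum>n. indicator (range (\<lambda>k. (Suc k)\<^sup>2)) n * x ^ n)) UNIV"
    using has_sum_power_subseq x by blast+
  have "((\<lambda>k::int. exp (- pi * (of_int k)\<^sup>2 * s) * e ^ nat \<bar>k\<bar>) has_sum
    ((\<Sum>n. indicator (range (\<lambda>k. k\<^sup>2)) n * x ^ n) + (\<Sum>n. indicator (range (\<lambda>k. (Suc k)\<^sup>2)) n * x ^ n))) UNIV"
  proof (rule has_sum_int_split)
    show "((\<lambda>n. exp (- pi * (of_int (int n))\<^sup>2 * s) * e ^ nat \<bar>int n\<bar>) has_sum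
        (\<Sum>n. indicator (range (\<lambda>k. k\<^sup>2)) n * x ^ n)) UNIV"
      using h(1) by (simp add: pw)
    have "exp (- pi * (of_int (- 1 - int n))\<^sup>2 * s) * e ^ nat \<bar>- 1 - int n\<bar> = x ^ (Suc n)\<^sup>2" for n
    proof -
      have "(real_of_int (- 1 - int n))\<^sup>2 = (real (Suc n))\<^sup>2" by (simp add: power2_eq_square algebra_simps)
      moreover have "nat \<bar>- 1 - int n\<bar> = Suc n" by simp
      ultimately show ?thesis by (simp only: pw)
    qed
    then show "((\<lambda>n. exp (- pi * (of_int (- 1 - int n))\<^sup>2 * s) * e ^ nat \<bar>- 1 - int n\<bar>) has_sum
        (\<Sum>n. indicator (range (\<lambda>k. (Suc k)\<^sup>2)) n * x ^ n)) UNIV"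
      using h(2) by simp
  qed
  also have "(\<Sum>n. indicator (range (\<lambda>k. k\<^sup>2)) n * x ^ n) + (\<Sum>n. indicator (range (\<lambda>k. (Suc k)\<^sup>2)) n * x ^ n)
     = (\<Sum>n. indicator (range (\<lambda>k. k\<^sup>2)) n * x ^ n + indicator (range (\<lambda>k. (Suc k)\<^sup>2)) n * x ^ n)"
    by (rule suminf_add[OF sm sm])
  also have "\<dots> = qseries (\<lambda>n. e ^ n * square_coeff n) (pi * s)"
    unfolding qseries_def square_coeff_def x_def
    by (intro arg_cong[of _ _ suminf] ext) (simp add: power_mult_distrib algebra_simps)
  finally show ?thesis .
qed

lemma theta3_qseries: "theta3 s = qseries square_coeff (pi * s)" if "s > 0"
  using infsumI[OF has_sum_signed_theta[of 1, OF _ that]] by (simp add: theta3_def)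

lemma theta4_qseries: "theta4 s = qseries (\<lambda>n. (- 1) ^ n * square_coeff n) (pi * s)" if "s > 0"
proof -
  have "cos (pi * real_of_int k) = (- 1) ^ nat \<bar>k\<bar>" for k :: int
  proof -
    have "cos (pi * real_of_int k) = cos (pi * real (nat \<bar>k\<bar>))"
      by (cases "k \<ge> 0") (simp_all add: abs_if)
    then show ?thesis by (simp only: cos_npi2)
  qed
  then show ?thesis
    using infsumI[OF has_sum_signed_theta[of "- 1", OF _ that]] by (simp add: theta4_def)
qed

lemma theta2_qseries: "theta2 s = 2 * exp (- pi * s / 4) * qseries oblong_coeff (pi * s)" if s: "s > 0"
proof -
  define x where "x = exp (- (pi * s))"
  have x: "\<bar>x\<bar> < 1" using s by (simp add: x_def)
  have "strict_mono (\<lambda>n::nat. n * Suc n)"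
    by (intro strict_monoI mult_strict_mono') auto
  from has_sum_cmult_right[OF has_sum_power_subseq[OF this x], of "exp (- pi * s / 4)"]
  have h: "((\<lambda>n. exp (- pi * s / 4) * x ^ (n * Suc n)) has_sum (exp (- pi * s / 4) * qseries oblong_coeff (pi * s))) UNIV"
    by (simp add: qseries_def oblong_coeff_def x_def)
  have pw: "exp (- pi * s / 4) * x ^ (n * Suc n) = exp (- pi * (real n + 1 / 2)\<^sup>2 * s)" for n
    unfolding x_def exp_of_nat_mult[symmetric] exp_add[symmetric]
    by (rule arg_cong[of _ _ exp]) (simp add: power2_eq_square field_simps)
  have "((\<lambda>k::int. exp (- pi * (of_int k + 1 / 2)\<^sup>2 * s)) has_sum
     (exp (- pi * s / 4) * qseries oblong_coeff (pi * s) + exp (- pi * s / 4) * qseries oblong_coeff (pi * s))) UNIV"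
  proof (rule has_sum_int_split)
    show "((\<lambda>n. exp (- pi * (of_int (int n) + 1 / 2)\<^sup>2 * s)) has_sum (exp (- pi * s / 4) * qseries oblong_coeff (pi * s))) UNIV"
      using h unfolding pw by simp
    have "(of_int (- 1 - int n) + 1 / 2 :: real)\<^sup>2 = (real n + 1 / 2)\<^sup>2" for n
      by (simp add: power2_eq_square algebra_simps)
    then show "((\<lambda>n. exp (- pi * (of_int (- 1 - int n) + 1 / 2)\<^sup>2 * s)) has_sum (exp (- pi * s / 4) * qseries oblong_coeff (pi * s))) UNIV"
      using h unfolding pw by (simp only:)
  qed
  then show ?thesis unfolding theta2_def by (simp add: infsumI)
qed

section \<open>Reflection formulas and positivity\<close>

lemma theta3_reflection: "theta3 s = theta3 (1 / s) / sqrt s" if "s > 0"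
  using poisson_summation_gaussian[OF that, of 0] by (simp add: theta3_def)

lemma theta2_reflection: "theta2 s = theta4 (1 / s) / sqrt s" if "s > 0"
  using poisson_summation_gaussian[OF that, of "1 / 2"] by (simp add: theta2_def theta4_def)

lemma theta3_pos: "theta3 s > 0" if "s > 0"
  unfolding theta3_qseries[OF that]
  by (rule qseries_pos) (use that square_coeff_bounds conv_square_coeff in auto)

lemma theta2_pos: "theta2 s > 0" if "s > 0"
proof -
  have "qseries oblong_coeff (pi * s) > 0"
    by (rule qseries_pos) (use that oblong_coeff_bounds conv_oblong_coeff in auto)
  then show ?thesis by (simp add: theta2_qseries[OF that])
qed

text \<open>The series has alternating signs; positivity is inherited from the positive terms of
  \<open>theta2\<close> through the reflection.\<close>

lemma theta4_pos: "theta4 s > 0" if "s > 0"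
proof -
  have "theta4 s / sqrt (1 / s) > 0"
    using theta2_reflection[of "1 / s"] theta2_pos[of "1 / s"] that by simp
  then show ?thesis using that by (simp add: zero_less_divide_iff)
qed

section \<open>Monotonicity of the logarithmic derivatives\<close>

lemma index_le_square: "real n \<le> (real n)\<^sup>2"
  by (cases n) (auto simp: power2_eq_square)

lemma one_le_square: "1 \<le> (real n)\<^sup>2 \<or> n < 2"
  by (cases "n < 2") (auto simp: one_le_power)

text \<open>Let \<open>P0\<close>, \<open>P1\<close>, \<open>P2\<close> be the series with weights
  1, \<open>n\<close>, \<open>n^2\<close>. Nonnegative coefficients give \<open>P1 <= P2\<close>, so
  \<open>P1 - z * P2\<close> is at most \<open>- (z - 1) * P1\<close>; this outweighs the square
  term because \<open>P1 <= 1 / 2\<close> and \<open>P0 \<ge> 1\<close>.\<close>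

lemma qlogd_square_antimono:
  assumes "3 \<le> x" "x \<le> y"
  shows "qlogd square_coeff y \<le> qlogd square_coeff x"
proof (rule DERIV_nonpos_imp_nonincreasing[OF assms(2)])
  fix z assume z: "x \<le> z" "z \<le> y"
  then have z3: "z \<ge> 3" using assms by simp
  define q where "q = exp (- z)"
  have q: "0 < q" "q \<le> 1 / 16" using exp_neg_le[OF z3] by (auto simp: q_def)
  note c0 = conv_square_coeff
  note c1 = conv_unit_disc_index_times[OF c0]
  note c2 = conv_unit_disc_index_times[OF c1]
  define P0 where "P0 = qseries square_coeff z"
  define P1 where "P1 = qseries (\<lambda>n. real n * square_coeff n) z"
  define P2 where "P2 = qseries (\<lambda>n. real n * (real n * square_coeff n)) z"
  have "\<bar>square_coeff n\<bar> \<le> 2 * (real n)\<^sup>2 \<or> n < 2" for n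
    using one_le_square[of n] square_coeff_bounds[of n] by linarith
  then have "\<bar>P0 - 1 - 2 * q\<bar> \<le> 2 * q / 3"
    using qseries_linear_approx[where B = 2, OF c0 z3] unfolding P0_def q_def by simp
  then have P0: "P0 \<ge> 1" using q by linarith
  have "\<bar>real n * square_coeff n\<bar> \<le> 2 * (real n)\<^sup>2" for n
    using mult_mono[OF index_le_square square_coeff_bounds(2), of n n] square_coeff_bounds[of n]
    by (simp add: abs_mult mult.commute)
  then have "\<bar>P1 - 2 * q\<bar> \<le> 2 * q / 3"
    using qseries_linear_approx[where B = 2, OF c1 z3] unfolding P1_def q_def by simp
  then have P1: "P1 \<ge> 0" "P1 \<le> 1 / 2" using q by linarith+
  have P2: "P1 \<le> P2" unfolding P1_def P2_def qseries_def
  proof (rule suminf_le)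
    fix n
    have "real n * square_coeff n \<le> real n * (real n * square_coeff n)"
      using index_le_square[of n] square_coeff_bounds(1)[of n]
      by (simp add: power2_eq_square mult_right_mono flip: mult.assoc)
    then show "real n * square_coeff n * exp (- z) ^ n \<le> real n * (real n * square_coeff n) * exp (- z) ^ n"
      by (intro mult_right_mono) auto
  qed (use summable_qseries[OF c1] summable_qseries[OF c2] z3 in auto)
  have "z * P1\<^sup>2 \<le> (z - 1) * P1 * P0"
  proof -
    have "z * P1\<^sup>2 = P1 * (z * P1)" by (simp add: power2_eq_square)
    also have "\<dots> \<le> P1 * ((z - 1) * P0)"
    proof (rule mult_left_mono[OF _ P1(1)])
      have "z * P1 \<le> z * (1 / 2)" using z3 P1 by (intro mult_left_mono) auto
      also have "\<dots> \<le> (z - 1) * 1" using z3 by simp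
      also have "\<dots> \<le> (z - 1) * P0" using z3 P0 by (intro mult_left_mono) auto
      finally show "z * P1 \<le> (z - 1) * P0" .
    qed
    finally show ?thesis by (simp add: mult_ac)
  qed
  moreover have "P1 - z * P2 \<le> - ((z - 1) * P1)"
    using mult_left_mono[OF P2, of z] z3 by (simp add: algebra_simps)
  then have "(P1 - z * P2) * P0 \<le> - ((z - 1) * P1) * P0" using P0 by (intro mult_right_mono) auto
  ultimately have "((P1 - z * P2) * P0 + z * P1\<^sup>2) / P0\<^sup>2 \<le> 0"
    by (intro divide_nonpos_nonneg) auto
  then have "(P1 - z * P2) / P0 + z * (P1 / P0)\<^sup>2 \<le> 0"
    using P0 by (simp add: add_divide_distrib power2_eq_square)
  moreover have "(qlogd square_coeff has_real_derivative (P1 - z * P2) / P0 + z * (P1 / P0)\<^sup>2) (at z)"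
    unfolding P0_def P1_def P2_def using P0 z3 by (intro DERIV_qlogd c0) (auto simp: P0_def)
  ultimately show "\<exists>D. (qlogd square_coeff has_real_derivative D) (at z) \<and> D \<le> 0" by blast
qed

text \<open>Both \<open>P1\<close> and \<open>P2\<close> are close to \<open>- 2 * q\<close>, so
  \<open>P1 - z * P2\<close> is about \<open>2 * (z - 1) * q\<close>. Errors of
  \<open>2 * q / 3\<close> leave it positive for \<open>z \<ge> 3\<close>, and the square term only
  helps.\<close>

lemma qlogd_alt_square_mono:
  assumes "3 \<le> x" "x \<le> y"
  shows "qlogd (\<lambda>n. (- 1) ^ n * square_coeff n) x \<le> qlogd (\<lambda>n. (- 1) ^ n * square_coeff n) y"
proof (rule DERIV_nonneg_imp_nondecreasing[OF assms(2)])
  fix z assume z: "x \<le> z" "z \<le> y"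
  then have z3: "z \<ge> 3" using assms by simp
  define q where "q = exp (- z)"
  have q: "0 < q" "q \<le> 1 / 16" using exp_neg_le[OF z3] by (auto simp: q_def)
  define c where "c = (\<lambda>n. (- 1) ^ n * square_coeff n)"
  have cb: "\<bar>c n\<bar> \<le> 2" for n
    using square_coeff_bounds[of n] by (simp add: c_def abs_mult)
  have [simp]: "c 0 = 1" "c (Suc 0) = - 2" by (simp_all add: c_def)
  have c0: "conv_unit_disc c" unfolding c_def by (rule conv_alt_square_coeff)
  note c1 = conv_unit_disc_index_times[OF c0]
  note c2 = conv_unit_disc_index_times[OF c1]
  define P0 where "P0 = qseries c z"
  define P1 where "P1 = qseries (\<lambda>n. real n * c n) z"
  define P2 where "P2 = qseries (\<lambda>n. real n * (real n * c n)) z"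
  have b0: "\<bar>c n\<bar> \<le> 2 * (real n)\<^sup>2 \<or> n < 2" for n
    using one_le_square[of n] cb[of n] by linarith
  have b1: "\<bar>real n * c n\<bar> \<le> 2 * (real n)\<^sup>2" for n
    using mult_mono[OF index_le_square cb, of n n] by (simp add: abs_mult mult.commute)
  have b2: "\<bar>real n * (real n * c n)\<bar> \<le> 2 * (real n)\<^sup>2" for n
    using mult_left_mono[OF cb, of "(real n)\<^sup>2" n] by (simp add: abs_mult power2_eq_square mult_ac)
  have "\<bar>P0 - 1 + 2 * q\<bar> \<le> 2 * q / 3"
    using qseries_linear_approx[where B = 2, OF c0 z3 b0] unfolding P0_def q_def by simp
  then have P0: "P0 > 0" using q by linarith
  have "\<bar>P1 + 2 * q\<bar> \<le> 2 * q / 3"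
    using qseries_linear_approx[where B = 2, OF c1 z3] b1 unfolding P1_def q_def by simp
  then have P1: "P1 \<ge> - (8 / 3) * q" by linarith
  have "\<bar>P2 + 2 * q\<bar> \<le> 2 * q / 3"
    using qseries_linear_approx[where B = 2, OF c2 z3] b2 unfolding P2_def q_def by simp
  then have "P2 \<le> - (4 / 3) * q" by linarith
  then have "z * P2 \<le> z * (- (4 / 3) * q)" using z3 by (intro mult_left_mono) auto
  also have "\<dots> \<le> 3 * (- (4 / 3) * q)" using z3 q by (intro mult_right_mono_neg) auto
  finally have "P1 - z * P2 \<ge> 0" using P1 q by linarith
  then have "(P1 - z * P2) / P0 + z * (P1 / P0)\<^sup>2 \<ge> 0"
    using P0 z3 by (intro add_nonneg_nonneg mult_nonneg_nonneg divide_nonneg_nonneg) auto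
  moreover have "(qlogd c has_real_derivative (P1 - z * P2) / P0 + z * (P1 / P0)\<^sup>2) (at z)"
    unfolding P0_def P1_def P2_def using P0 z3 by (intro DERIV_qlogd c0) (auto simp: P0_def)
  ultimately show "\<exists>D. (qlogd (\<lambda>n. (- 1) ^ n * square_coeff n) has_real_derivative D) (at z) \<and> D \<ge> 0"
    unfolding c_def by blast
qed

text \<open>The summand \<open>z / 4\<close> stems from the prefactor \<open>q^(1/4)\<close> of
  \<open>theta2\<close>. Its derivative 1/4 absorbs the only negative contribution
  \<open>z * P2\<close>, which is small because the coefficients of \<open>P2\<close> at 0 and 1
  vanish.\<close>

lemma qlogd_oblong_mono:
  assumes "3 \<le> x" "x \<le> y"
  shows "x / 4 + qlogd oblong_coeff x \<le> y / 4 + qlogd oblong_coeff y"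
proof (rule DERIV_nonneg_imp_nondecreasing[OF assms(2)])
  fix z assume z: "x \<le> z" "z \<le> y"
  then have z3: "z \<ge> 3" using assms by simp
  define q where "q = exp (- z)"
  have q: "0 < q" "q \<le> 1 / 16" using exp_neg_le[OF z3] by (auto simp: q_def)
  have c0: "conv_unit_disc oblong_coeff" by (rule conv_oblong_coeff)
  note c1 = conv_unit_disc_index_times[OF c0]
  note c2 = conv_unit_disc_index_times[OF c1]
  define P0 where "P0 = qseries oblong_coeff z"
  define P1 where "P1 = qseries (\<lambda>n. real n * oblong_coeff n) z"
  define P2 where "P2 = qseries (\<lambda>n. real n * (real n * oblong_coeff n)) z"
  have "1 = (\<Sum>n<1. oblong_coeff n * exp (- z) ^ n)" by simp
  also have "\<dots> \<le> P0" unfolding P0_def qseries_def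
    by (intro sum_le_suminf summable_qseries c0) (use oblong_coeff_bounds z3 in auto)
  finally have P0: "P0 \<ge> 1" .
  have P1: "P1 \<ge> 0" unfolding P1_def qseries_def
    by (intro suminf_nonneg summable_qseries c1) (use oblong_coeff_bounds z3 in auto)
  have b2: "\<bar>real n * (real n * oblong_coeff n)\<bar> \<le> (real n)\<^sup>2" for n
    using mult_left_mono[OF oblong_coeff_bounds(2), of "(real n)\<^sup>2" n] oblong_coeff_bounds(1)[of n]
    by (simp add: abs_mult power2_eq_square mult_ac)
  have "\<bar>P2\<bar> \<le> q / 3"
    using qseries_linear_approx[where B = 1, OF c2 z3] b2 unfolding P2_def q_def by simp
  then have "z * P2 \<le> z * (q / 3)" using z3 by (intro mult_left_mono) auto
  moreover have "z * q \<le> 3 / 4"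
  proof -
    \<comment> \<open>The quadratic Taylor bound gives \<open>exp z \<ge> 4 * z / 3\<close>; with
      \<open>P2 <= q / 3\<close> the constant 3/4 yields exactly the required 1/4.\<close>
    have "3 * z \<le> z\<^sup>2" unfolding power2_eq_square using z3 by (intro mult_right_mono) auto
    then have "z * (4 / 3) \<le> 1 + z + z\<^sup>2 / 2" using z3 by linarith
    also have "\<dots> \<le> exp z" using exp_lower_Taylor_quadratic[of z] z3 by simp
    finally show ?thesis by (simp add: q_def exp_minus field_simps)
  qed
  ultimately have "z * P2 \<le> 1 / 4" by simp
  then have "- (1 / 4) \<le> P1 - z * P2" using P1 by linarith
  \<comment> \<open>Because \<open>P0 \<ge> 1\<close>, the lower bound -1/4 survives division by
    \<open>P0\<close>.\<close>
  also have "- (1 / 4) * P0 \<le> - (1 / 4)" using P0 by simp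
  finally have "- (1 / 4) \<le> (P1 - z * P2) / P0"
    using P0 by (simp add: field_simps)
  moreover have "z * (P1 / P0)\<^sup>2 \<ge> 0" using z3 by simp
  ultimately have "1 / 4 + ((P1 - z * P2) / P0 + z * (P1 / P0)\<^sup>2) \<ge> 0" by linarith
  moreover have "(qlogd oblong_coeff has_real_derivative (P1 - z * P2) / P0 + z * (P1 / P0)\<^sup>2) (at z)"
    unfolding P0_def P1_def P2_def using P0 z3 by (intro DERIV_qlogd c0) (auto simp: P0_def)
  then have "((\<lambda>z. z / 4 + qlogd oblong_coeff z) has_real_derivative 1 / 4 + ((P1 - z * P2) / P0 + z * (P1 / P0)\<^sup>2)) (at z)"
    by (intro DERIV_add) (auto intro!: derivative_eq_intros)
  ultimately show "\<exists>D. ((\<lambda>z. z / 4 + qlogd oblong_coeff z) has_real_derivative D) (at z) \<and> D \<ge> 0"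
    by blast
qed

section \<open>Product inequalities and the minimum\<close>

lemma pi_mult_ge_3: "3 \<le> pi * s" if "1 \<le> s"
  using mult_mono[of 3 pi 1 s] pi_gt3 that by simp

text \<open>Midpoint convexity of \<open>ln theta3\<close> in \<open>ln s\<close>. The function is
  its own reflection partner, and the factor \<open>1 / sqrt s\<close> gives
  \<open>p = - 1 / 2\<close>.\<close>

lemma theta3_product_ge:
  assumes r: "r > 0" and s: "s > 0"
  shows "theta3 r * theta3 r \<le> theta3 (r * s) * theta3 (r / s)"
proof -
  have deriv: "((\<lambda>s. ln (theta3 s)) has_real_derivative - qlogd square_coeff (pi * s) / s) (at s)" if "s > 0" for s
  proof -
    have "((\<lambda>s. ln (qseries square_coeff (pi * s))) has_real_derivative - qlogd square_coeff (pi * s) / s) (at s)"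
      using that theta3_pos[OF that] by (intro DERIV_ln_qseries conv_square_coeff) (simp_all add: theta3_qseries)
    then show ?thesis
      by (rule has_field_derivative_transform_within_open[where S = "{0<..}"]) (use that theta3_qseries in auto)
  qed
  have "2 * ln (theta3 r) \<le> ln (theta3 (r * s)) + ln (theta3 (r / s))"
  proof (rule midpoint_le_of_reflection[OF deriv deriv _ _ _ r s, where p = "- 1 / 2"])
    show "ln (theta3 s) = ln (theta3 (1 / s)) + - 1 / 2 * ln s" if "s > 0" for s
      using that theta3_pos[of "1 / s"] by (subst theta3_reflection[OF that]) (simp add: ln_div ln_sqrt)
    show "s * (- qlogd square_coeff (pi * s) / s) \<le> t * (- qlogd square_coeff (pi * t) / t)" if "1 \<le> s" "s \<le> t" for s t
      using qlogd_square_antimono[OF pi_mult_ge_3, of s "pi * t"] that by simp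
    then show "s * (- qlogd square_coeff (pi * s) / s) \<le> t * (- qlogd square_coeff (pi * t) / t)" if "1 \<le> s" "s \<le> t" for s t
      using that by blast
  qed
  then have "ln (theta3 r * theta3 r) \<le> ln (theta3 (r * s) * theta3 (r / s))"
    using r s theta3_pos by (simp add: ln_mult less_imp_neq[symmetric])
  then show ?thesis using r s theta3_pos by (subst (asm) ln_le_cancel_iff) auto
qed

text \<open>Midpoint convexity of \<open>- ln theta2\<close> in \<open>ln s\<close>, with reflection
  partner \<open>- ln theta4\<close>; the change of sign turns the coefficient into
  \<open>p = 1 / 2\<close>.\<close>

lemma theta2_product_le:
  assumes r: "r > 0" and s: "s > 0"
  shows "theta2 (r * s) * theta2 (r / s) \<le> theta2 r * theta2 r"
proof -
  let ?c4 = "\<lambda>n. (- 1) ^ n * square_coeff n"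
  have deriv4: "((\<lambda>s. - ln (theta4 s)) has_real_derivative qlogd ?c4 (pi * s) / s) (at s)" if "s > 0" for s
  proof -
    have "((\<lambda>s. ln (qseries ?c4 (pi * s))) has_real_derivative - qlogd ?c4 (pi * s) / s) (at s)"
      using that theta4_pos[OF that] by (intro DERIV_ln_qseries conv_alt_square_coeff) (simp_all add: theta4_qseries)
    from DERIV_minus[OF this]
    have "((\<lambda>s. - ln (qseries ?c4 (pi * s))) has_real_derivative qlogd ?c4 (pi * s) / s) (at s)" by simp
    then show ?thesis
      by (rule has_field_derivative_transform_within_open[where S = "{0<..}"]) (use that theta4_qseries in auto)
  qed
  have deriv2: "((\<lambda>s. - ln (theta2 s)) has_real_derivative ((pi * s) / 4 + qlogd oblong_coeff (pi * s)) / s) (at s)" if "s > 0" for s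
  proof -
    have pos: "qseries oblong_coeff (pi * s) > 0" if "s > 0" for s
      by (rule qseries_pos) (use that oblong_coeff_bounds conv_oblong_coeff in auto)
    have "((\<lambda>s. ln (qseries oblong_coeff (pi * s))) has_real_derivative - qlogd oblong_coeff (pi * s) / s) (at s)"
      using that pos by (intro DERIV_ln_qseries conv_oblong_coeff) auto
    \<comment> \<open>The affine part is minus the logarithm of the prefactor
      \<open>2 * exp (- pi * s / 4)\<close> of \<open>theta2\<close>.\<close>
    then have "((\<lambda>s. (pi * s / 4 - ln 2) - ln (qseries oblong_coeff (pi * s))) has_real_derivative
        pi / 4 - (- qlogd oblong_coeff (pi * s) / s)) (at s)"
      by (intro DERIV_diff) (auto intro!: derivative_eq_intros)
    also have "pi / 4 - (- qlogd oblong_coeff (pi * s) / s) = ((pi * s) / 4 + qlogd oblong_coeff (pi * s)) / s"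
      using that by (simp add: field_simps)
    finally show ?thesis
    proof (rule has_field_derivative_transform_within_open[where S = "{0<..}"])
      fix x :: real assume "x \<in> {0<..}"
      then show "(pi * x / 4 - ln 2) - ln (qseries oblong_coeff (pi * x)) = - ln (theta2 x)"
        using pos[of x] by (simp add: theta2_qseries ln_mult)
    qed (use that in auto)
  qed
  have "2 * (- ln (theta2 r)) \<le> - ln (theta2 (r * s)) + - ln (theta2 (r / s))"
  proof (rule midpoint_le_of_reflection[OF deriv2 deriv4 _ _ _ r s, where p = "1 / 2"])
    show "- ln (theta2 s) = - ln (theta4 (1 / s)) + 1 / 2 * ln s" if "s > 0" for s
      using that theta4_pos[of "1 / s"] by (subst theta2_reflection[OF that]) (simp add: ln_div ln_sqrt)
    show "s * (((pi * s) / 4 + qlogd oblong_coeff (pi * s)) / s) \<le> t * (((pi * t) / 4 + qlogd oblong_coeff (pi * t)) / t)"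
      if "1 \<le> s" "s \<le> t" for s t
      using qlogd_oblong_mono[OF pi_mult_ge_3, of s "pi * t"] that by simp
    show "s * (qlogd ?c4 (pi * s) / s) \<le> t * (qlogd ?c4 (pi * t) / t)" if "1 \<le> s" "s \<le> t" for s t
      using qlogd_alt_square_mono[OF pi_mult_ge_3, of s "pi * t"] that by simp
  qed
  then have "ln (theta2 (r * s) * theta2 (r / s)) \<le> ln (theta2 r * theta2 r)"
    using r s theta2_pos by (simp add: ln_mult less_imp_neq[symmetric])
  then show ?thesis using r s theta2_pos by (subst (asm) ln_le_cancel_iff) auto
qed

lemma theta_o_eq_theta2: "theta_o s = theta2 (4 * s)"
  unfolding theta_o_def theta2_def
  by (intro infsum_cong arg_cong[of _ _ exp]) (simp add: power2_eq_square field_simps)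

theorem theorem5:
  fixes r :: real
  assumes "r > 0"
  shows "is_arg_min (\<lambda>s. theta3 (r * s) * theta3 (r / s) - 2 * theta_o (r * s) * theta_o (r / s))
           (\<lambda>s. s > 0) 1"
proof -
  \<comment> \<open>The bound for \<open>theta2\<close> is applied at \<open>4 * r\<close>, since
    the odd sum has its argument scaled by 4.\<close>
  have "theta3 r * theta3 r - 2 * theta_o r * theta_o r \<le>
      theta3 (r * s) * theta3 (r / s) - 2 * theta_o (r * s) * theta_o (r / s)" if "s > 0" for s
    using theta3_product_ge[OF assms that] theta2_product_le[of "4 * r" s] assms that
    by (simp add: theta_o_eq_theta2 mult.assoc)
  \<comment> \<open>\<open>is_arg_min\<close> demands that no admissible point has a strictly
    smaller value, hence the negated strict form.\<close>
  then have "\<not> theta3 (r * s) * theta3 (r / s) - 2 * theta_o (r * s) * theta_o (r / s) <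
      theta3 r * theta3 r - 2 * theta_o r * theta_o r" if "s > 0" for s
    using that by (simp only: not_less)
  then show ?thesis by (auto simp only: is_arg_min_def mult_1_right div_by_1 zero_less_one)
qed

end
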